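(* Let $f:\mathbb{R}^n\to\mathbb{R}^n$ be a $C^1$ vector field with flow $\phi_t$, let $X\subseteq\mathbb{R}^n$ be a compact forward invariant set (the state space), and suppose that $\dot x=f(x)$ is nonexpansive on $X$ with respect to a strictly convex norm $\|\cdot\|$ on $\mathbb{R}^n$. Let $\mathbb{A}=\bigcap_{t\ge0}\phi_t(X)$, assume $0\in\mathbb{A}$ and $f(0)=0$, and let $V$ be the linear span of $\mathbb{A}$. Let $(F_t)_{t\in\mathbb{R}}$ be the family of linear isometries $F_t:V\to V$ such that $F_t$ extends $\phi_t|_{\mathbb{A}}$ for each $t$. Then $F_t=e^{Bt}$ for all $t\in\mathbb{R}$, for some linear transformation $B$ on $V$.
   Context: $\phi_t$ denotes the time evolution of $\dot x=f(x)$, assumed defined for all $t\ge0$. Nonexpansive on $X$ means $\|\phi_t(x)-\phi_t(y)\|\le\|x-y\|$ for all $x,y\in X$, $t>0$. A norm is strictly convex if whenever $x\ne y$ and $\|x\|=\|y\|=r>0$, then $\|\alpha x+(1-\alpha)y\|<r$ for $0<\alpha<1$. The set $\mathbb{A}$ (the global attractor relative to $X$) is forward and backward invariant, so $\phi_t|_{\mathbb{A}}:\mathbb{A}\to\mathbb{A}$ is defined for every $t\in\mathbb{R}$. $V$ carries the restriction of $\|\cdot\|$. The $F_t$ are affine isometries of $V$ extending $\phi_t|_{\mathbb{A}}$; since $\phi_t(0)=0$ they are linear, and they are determined by $\phi_t|_{\mathbb{A}}$ because $\mathbb{A}$ spans $V$. *)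

theory Defs
  imports "HOL-Analysis.Analysis"
begin

section \<open>Norms given as functions\<close>

text \<open>The norm of the statement is an arbitrary one and need not be the library norm of the type, so
  it is a function satisfying the norm axioms.\<close>

definition is_norm :: "('a::real_vector \<Rightarrow> real) \<Rightarrow> bool" where
  "is_norm N \<longleftrightarrow>
     (\<forall>x. 0 \<le> N x) \<and> (\<forall>x. N x = 0 \<longleftrightarrow> x = 0) \<and>
     (\<forall>c x. N (c *\<^sub>R x) = \<bar>c\<bar> * N x) \<and> (\<forall>x y. N (x + y) \<le> N x + N y)"

definition strictly_convex_norm :: "('a::real_vector \<Rightarrow> real) \<Rightarrow> bool" where
  "strictly_convex_norm N \<longleftrightarrow> is_norm N \<and>
     (\<forall>x y r \<alpha>. x \<noteq> y \<longrightarrow> N x = r \<longrightarrow> N y = r \<longrightarrow> 0 < r \<longrightarrow> 0 < \<alpha> \<longrightarrow> \<alpha> < 1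
        \<longrightarrow> N (\<alpha> *\<^sub>R x + (1 - \<alpha>) *\<^sub>R y) < r)"

section \<open>Vector fields and their time evolution\<close>

definition C1_vector_field :: "('a::euclidean_space \<Rightarrow> 'a) \<Rightarrow> bool" where
  "C1_vector_field f \<longleftrightarrow>
     (\<exists>f' :: 'a \<Rightarrow> ('a \<Rightarrow>\<^sub>L 'a).
        (\<forall>x. (f has_derivative blinfun_apply (f' x)) (at x)) \<and> continuous_on UNIV f')"

definition solves_ode_on :: "('a::real_normed_vector \<Rightarrow> 'a) \<Rightarrow> (real \<Rightarrow> 'a) \<Rightarrow> real set \<Rightarrow> bool" where
  "solves_ode_on f u T \<longleftrightarrow> (\<forall>s\<in>T. (u has_vector_derivative f (u s)) (at s within T))"

text \<open>\<open>flow f t x\<close> is the value at time \<open>t\<close>, of either sign, of the solution starting at \<open>x\<close>. For a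
  \<open>C\<^sup>1\<close> vector field solutions are unique, so the value is meaningful exactly when the solution
  through \<open>x\<close> extends to the interval between \<open>0\<close> and \<open>t\<close>; it is unspecified otherwise.\<close>

definition flow :: "('a::real_normed_vector \<Rightarrow> 'a) \<Rightarrow> real \<Rightarrow> 'a \<Rightarrow> 'a" where
  "flow f t x = (THE y. \<exists>u. u 0 = x \<and> u t = y \<and> solves_ode_on f u (closed_segment 0 t))"

definition forward_complete :: "('a::real_normed_vector \<Rightarrow> 'a) \<Rightarrow> bool" where
  "forward_complete f \<longleftrightarrow> (\<forall>x. \<exists>u. u 0 = x \<and> solves_ode_on f u {0..})"

definition forward_invariant :: "('a::real_normed_vector \<Rightarrow> 'a) \<Rightarrow> 'a set \<Rightarrow> bool" where
  "forward_invariant f X \<longleftrightarrow> (\<forall>t\<ge>0. flow f t ` X \<subseteq> X)"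

definition nonexpansive_on ::
    "('a::real_normed_vector \<Rightarrow> real) \<Rightarrow> ('a \<Rightarrow> 'a) \<Rightarrow> 'a set \<Rightarrow> bool" where
  "nonexpansive_on N f X \<longleftrightarrow>
     (\<forall>x\<in>X. \<forall>y\<in>X. \<forall>t>0. N (flow f t x - flow f t y) \<le> N (x - y))"

definition global_attractor :: "('a::real_normed_vector \<Rightarrow> 'a) \<Rightarrow> 'a set \<Rightarrow> 'a set" where
  "global_attractor f X = (\<Inter>t\<in>{0..}. flow f t ` X)"

section \<open>Linear maps on a subspace\<close>

text \<open>A linear transformation of a subspace \<open>V\<close> is a function on the ambient space whose values
  outside \<open>V\<close> are irrelevant.\<close>

definition linear_transformation_on :: "'a::real_vector set \<Rightarrow> ('a \<Rightarrow> 'a) \<Rightarrow> bool" where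
  "linear_transformation_on V T \<longleftrightarrow>
     T ` V \<subseteq> V \<and> (\<forall>v\<in>V. \<forall>w\<in>V. T (v + w) = T v + T w) \<and>
     (\<forall>c. \<forall>v\<in>V. T (c *\<^sub>R v) = c *\<^sub>R T v)"

definition linear_isometry_on ::
    "('a::real_vector \<Rightarrow> real) \<Rightarrow> 'a set \<Rightarrow> ('a \<Rightarrow> 'a) \<Rightarrow> bool" where
  "linear_isometry_on N V T \<longleftrightarrow>
     linear_transformation_on V T \<and> (\<forall>v\<in>V. \<forall>w\<in>V. N (T v - T w) = N (v - w))"

definition op_exp :: "('a::real_normed_vector \<Rightarrow> 'a) \<Rightarrow> 'a \<Rightarrow> 'a" where
  "op_exp B v = (\<Sum>k. (B ^^ k) v /\<^sub>R fact k)"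

text \<open>The exponential series always converges in the case of interest, so \<open>op_exp\<close> is never an
  unspecified value there.\<close>

lemma op_exp_sums:
  fixes B :: "'a::euclidean_space \<Rightarrow> 'a"
  assumes V: "subspace V" and B: "linear_transformation_on V B" and v: "v \<in> V"
  shows "(\<lambda>k. (B ^^ k) v /\<^sub>R fact k) sums op_exp B v"
proof -
  obtain S where S: "S \<subseteq> V" "independent S" "V \<subseteq> span S"
    using maximal_independent_subset[of V] by metis
  obtain g where g: "linear g" "\<forall>x\<in>S. g x = B x"
    using linear_independent_extend[OF S(2)] by metis
  have B0: "B 0 = 0"
    using B subspace_0[OF V] unfolding linear_transformation_on_def
    by (metis scale_zero_left)
  have eq: "g x = B x \<and> x \<in> V" if "x \<in> span S" for x
    using that
  proof (induction rule: span_induct_alt)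
    case base
    then show ?case using B0 g(1) V by (simp add: linear_0 subspace_0)
  next
    case (step c x y)
    then have "x \<in> V" "y \<in> V" "c *\<^sub>R x \<in> V"
      using S(1) V by (auto simp: subspace_scale)
    then show ?case
      using B g step V
      by (simp add: linear_transformation_on_def linear_add linear_scale subspace_add)
  qed
  have pow: "(B ^^ k) v \<in> V \<and> (B ^^ k) v = (g ^^ k) v" for k
  proof (induction k)
    case 0
    then show ?case using v by simp
  next
    case (Suc k)
    then show ?case
      using B eq S(3) by (auto simp: linear_transformation_on_def)
  qed
  have bl: "bounded_linear g"
    using g(1) by (simp add: linear_conv_bounded_linear)
  have bound: "norm ((g ^^ k) v) \<le> onorm g ^ k * norm v" for k
  proof (induction k)
    case (Suc k)
    have "norm ((g ^^ Suc k) v) \<le> onorm g * norm ((g ^^ k) v)"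
      using onorm[OF bl] by simp
    also have "\<dots> \<le> onorm g * (onorm g ^ k * norm v)"
      using Suc onorm_pos_le[OF bl] by (rule mult_left_mono)
    finally show ?case by (simp add: mult.assoc)
  qed simp
  have "summable (\<lambda>k. (onorm g ^ k /\<^sub>R fact k) * norm v)"
    using summable_exp_generic[of "onorm g"] by (intro summable_mult2)
  then have "summable (\<lambda>k. (g ^^ k) v /\<^sub>R fact k)"
  proof (rule summable_comparison_test')
    fix k :: nat
    show "norm ((g ^^ k) v /\<^sub>R fact k) \<le> (onorm g ^ k /\<^sub>R fact k) * norm v"
      using bound[of k] by (simp add: divide_simps)
  qed
  then show ?thesis
    using pow by (simp add: op_exp_def summable_sums)
qed

end

theory Submission
  imports Defs
begin

text \<open>The attractor \<open>A\<close> consists of points whose solutions exist, and stay in \<open>A\<close>, for all times of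
  both signs, because a point of \<open>A\<close> is reached from \<open>X\<close> after every waiting time. Hence
  \<open>t \<mapsto> F t a\<close> is, for \<open>a \<in> A\<close>, a solution of \<open>u' = f(u)\<close> on the whole line
  (\<open>flow_has_vector_derivative_on_global_attractor\<close>, \<open>flow_on_global_attractor\<close>); in particular
  it is differentiable. As \<open>A\<close> spans \<open>V\<close> and every \<open>F t\<close> is linear, \<open>t \<mapsto> F t v\<close> is
  differentiable for every \<open>v \<in> V\<close>, and its derivative at \<open>0\<close>, as a function of \<open>v\<close>, is a
  linear map \<open>B\<close> of \<open>V\<close> that agrees with \<open>f\<close> on \<open>A\<close>.

  For \<open>a \<in> A\<close> the nonlinear equation therefore reads \<open>(F t a)' = f(F t a) = B (F t a)\<close>,
  since \<open>F t a\<close> is again in \<open>A\<close>. The outer two sides are linear in \<open>a\<close>, so their equality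
  extends to \<open>V\<close>. A linear
  equation with constant coefficients has all derivatives of its solutions under control, and
  Taylor's formula identifies the solution with the exponential series
  (\<open>linear_ode_solution_sums\<close>, \<open>op_exp_linear_ode\<close>).

  The flow is defined as the unique value of some solution, so every statement about it rests on
  uniqueness of solutions (\<open>solves_ode_on_unique\<close>), which for a \<open>C\<^sup>1\<close> field follows from a
  Gronwall estimate.\<close>

section \<open>Uniqueness of solutions\<close>

text \<open>A global Lipschitz constant need not exist; a ball suffices because a
  solution on a compact time interval is bounded.\<close>

lemma C1_vector_field_lipschitz_on_cball:
  fixes f :: "'a::euclidean_space \<Rightarrow> 'a"
  assumes "C1_vector_field f"
  shows "\<exists>L\<ge>0. \<forall>x\<in>cball 0 r. \<forall>y\<in>cball 0 r. norm (f x - f y) \<le> L * norm (x - y)"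
proof -
  obtain f' :: "'a \<Rightarrow> ('a \<Rightarrow>\<^sub>L 'a)"
    where f': "\<And>x. (f has_derivative blinfun_apply (f' x)) (at x)"
      and cont: "continuous_on UNIV f'"
    using assms unfolding C1_vector_field_def by blast
  have "compact (f' ` cball 0 r)"
    by (intro compact_continuous_image continuous_on_subset[OF cont]) auto
  then obtain L where L: "L > 0" "\<And>x. x \<in> cball 0 r \<Longrightarrow> norm (f' x) \<le> L"
    using compact_imp_bounded bounded_pos by (metis imageI)
  have "norm (f x - f y) \<le> L * norm (x - y)" if "x \<in> cball 0 r" "y \<in> cball 0 r" for x y
  proof (rule differentiable_bound[of "cball 0 r"])
    fix z assume "z \<in> cball (0::'a) r"
    then show "onorm (blinfun_apply (f' z)) \<le> L"
      using L(2) by (simp add: norm_blinfun.rep_eq[symmetric])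
    show "(f has_derivative blinfun_apply (f' z)) (at z within cball 0 r)"
      using f' has_derivative_at_withinI by blast
  qed (use that in auto)
  with L(1) show ?thesis by (intro exI[of _ L]) auto
qed

lemma solves_ode_on_subset:
  "solves_ode_on f u T \<Longrightarrow> S \<subseteq> T \<Longrightarrow> solves_ode_on f u S"
  unfolding solves_ode_on_def by (meson has_vector_derivative_within_subset subsetD)

lemma solves_ode_on_shift:
  assumes "solves_ode_on f u T" "(\<lambda>s. s + r) ` S \<subseteq> T"
  shows "solves_ode_on f (\<lambda>s. u (s + r)) S"
  unfolding solves_ode_on_def
proof
  fix s assume s: "s \<in> S"
  have "(u has_vector_derivative f (u (s + r))) (at (s + r) within (\<lambda>s. s + r) ` S)"
    using solves_ode_on_subset[OF assms] s unfolding solves_ode_on_def by auto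
  moreover have "((\<lambda>s. s + r) has_vector_derivative 1) (at s within S)"
    by (auto intro!: derivative_eq_intros)
  ultimately have "((u \<circ> (\<lambda>s. s + r)) has_vector_derivative 1 *\<^sub>R f (u (s + r))) (at s within S)"
    by (intro vector_diff_chain_within)
  then show "((\<lambda>s. u (s + r)) has_vector_derivative f (u (s + r))) (at s within S)"
    by (simp add: o_def)
qed

text \<open>Gronwall's argument: with \<open>e = |u - w|\<^sup>2\<close> and a Lipschitz constant \<open>L\<close> valid near both
  solutions, \<open>|e'| \<le> 2 L e\<close>. So \<open>e(s) exp(- 2 L s)\<close> decreases, which carries \<open>e = 0\<close> forward in
  time from \<open>c\<close>, and \<open>e(s) exp(2 L s)\<close> increases, which carries it backward.\<close>

lemma solves_ode_on_unique:
  fixes f :: "'a::euclidean_space \<Rightarrow> 'a"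
  assumes f: "C1_vector_field f"
    and u: "solves_ode_on f u {a..b}" and w: "solves_ode_on f w {a..b}"
    and c: "c \<in> {a..b}" "u c = w c" and t: "t \<in> {a..b}"
  shows "u t = w t"
proof -
  have cont: "continuous_on {a..b} u" "continuous_on {a..b} w"
    using u w unfolding solves_ode_on_def
    by (meson continuous_on_eq_continuous_within has_vector_derivative_continuous)+
  have "bounded (u ` {a..b} \<union> w ` {a..b})"
    using cont by (simp add: compact_continuous_image compact_imp_bounded)
  then obtain r where r: "\<And>s. s \<in> {a..b} \<Longrightarrow> u s \<in> cball 0 r \<and> w s \<in> cball 0 r"
    unfolding bounded_iff by (metis UnCI imageI mem_cball_0)
  obtain L where L: "\<And>x y. x \<in> cball 0 r \<Longrightarrow> y \<in> cball 0 r \<Longrightarrow> norm (f x - f y) \<le> L * norm (x - y)"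
    using C1_vector_field_lipschitz_on_cball[OF f, of r] by blast
  define d where "d s = u s - w s" for s
  define e where "e s = d s \<bullet> d s" for s
  define e' where "e' s = 2 * (d s \<bullet> (f (u s) - f (w s)))" for s
  have e': "(e has_real_derivative e' s) (at s)" if "a < s" "s < b" for s
  proof -
    have "at s within {a..b} = at s"
      using that by (simp add: at_within_Icc_at)
    then have "(u has_vector_derivative f (u s)) (at s)" "(w has_vector_derivative f (w s)) (at s)"
      using u w that unfolding solves_ode_on_def by (metis atLeastAtMost_iff less_imp_le)+
    then have "(d has_vector_derivative f (u s) - f (w s)) (at s)"
      unfolding d_def by (rule has_vector_derivative_diff)
    then have "(d has_derivative (\<lambda>h. h *\<^sub>R (f (u s) - f (w s)))) (at s)"
      by (simp add: has_vector_derivative_def)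
    from has_derivative_inner[OF this this] show ?thesis
      unfolding e_def e'_def has_field_derivative_def
      by (rule has_derivative_eq_rhs) (auto simp: inner_commute algebra_simps)
  qed
  have bound: "\<bar>e' s\<bar> \<le> 2 * L * e s" if "a < s" "s < b" for s
  proof -
    have "\<bar>d s \<bullet> (f (u s) - f (w s))\<bar> \<le> norm (d s) * norm (f (u s) - f (w s))"
      by (rule Cauchy_Schwarz_ineq2)
    also have "\<dots> \<le> norm (d s) * (L * norm (d s))"
      unfolding d_def using r[of s] that by (intro mult_left_mono L) auto
    finally show ?thesis
      unfolding e_def e'_def by (simp add: abs_mult dot_square_norm power2_eq_square algebra_simps)
  qed
  have cont_e: "continuous_on {a..b} e"
    unfolding e_def d_def by (intro continuous_intros cont)
  have "e t \<le> 0"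
  proof (cases "c \<le> t")
    case True
    have "e t * exp (- 2 * L * t) \<le> e c * exp (- 2 * L * c)"
    proof (rule DERIV_nonpos_imp_decreasing_open[OF True])
      show "continuous_on {c..t} (\<lambda>s. e s * exp (- 2 * L * s))"
        using c t by (intro continuous_intros continuous_on_subset[OF cont_e]) auto
      fix s assume s: "c < s" "s < t"
      then have s': "a < s" "s < b" using c t by auto
      have "((\<lambda>s. e s * exp (- 2 * L * s)) has_real_derivative
          (e' s - 2 * L * e s) * exp (- 2 * L * s)) (at s)"
        by (rule derivative_eq_intros e'[OF s'] refl)+ (simp add: algebra_simps)
      moreover have "(e' s - 2 * L * e s) * exp (- 2 * L * s) \<le> 0"
        using bound[OF s'] by (intro mult_nonpos_nonneg) auto
      ultimately show "\<exists>y. ((\<lambda>s. e s * exp (- 2 * L * s)) has_real_derivative y) (at s) \<and> y \<le> 0"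
        by blast
    qed
    then show ?thesis using c by (simp add: e_def[of c] d_def mult_le_0_iff)
  next
    case False
    then have "t \<le> c" by simp
    then have "e t * exp (2 * L * t) \<le> e c * exp (2 * L * c)"
    proof (rule DERIV_nonneg_imp_increasing_open)
      show "continuous_on {t..c} (\<lambda>s. e s * exp (2 * L * s))"
        using c t by (intro continuous_intros continuous_on_subset[OF cont_e]) auto
      fix s assume s: "t < s" "s < c"
      then have s': "a < s" "s < b" using c t by auto
      have "((\<lambda>s. e s * exp (2 * L * s)) has_real_derivative
          (e' s + 2 * L * e s) * exp (2 * L * s)) (at s)"
        by (rule derivative_eq_intros e'[OF s'] refl)+ (simp add: algebra_simps)
      moreover have "(e' s + 2 * L * e s) * exp (2 * L * s) \<ge> 0"
        using bound[OF s'] by (intro mult_nonneg_nonneg) auto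
      ultimately show "\<exists>y. ((\<lambda>s. e s * exp (2 * L * s)) has_real_derivative y) (at s) \<and> y \<ge> 0"
        by blast
    qed
    then show ?thesis using c by (simp add: e_def[of c] d_def mult_le_0_iff)
  qed
  then show ?thesis
    by (metis e_def d_def inner_gt_zero_iff not_less right_minus_eq)
qed

section \<open>The flow and its global attractor\<close>

lemma flow_eq_solution:
  fixes f :: "'a::euclidean_space \<Rightarrow> 'a"
  assumes f: "C1_vector_field f" and u: "solves_ode_on f u (closed_segment 0 t)"
  shows "flow f t (u 0) = u t"
  unfolding flow_def
proof (rule the_equality)
  show "\<exists>w. w 0 = u 0 \<and> w t = u t \<and> solves_ode_on f w (closed_segment 0 t)"
    using u by blast
  fix y assume "\<exists>w. w 0 = u 0 \<and> w t = y \<and> solves_ode_on f w (closed_segment 0 t)"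
  then obtain w where w: "w 0 = u 0" "w t = y" "solves_ode_on f w (closed_segment 0 t)"
    by blast
  have seg: "closed_segment 0 t = {min 0 t..max 0 t}"
    by (auto simp: closed_segment_eq_real_ivl)
  show "y = u t"
    using solves_ode_on_unique[OF f w(3)[unfolded seg] u[unfolded seg], of 0 t] w(1,2) by auto
qed

text \<open>Only forward existence of solutions is assumed. Negative times are meaningful at those
  points that lie on the forward orbit of another point, which includes all points of the
  attractor.\<close>

locale forward_complete_C1_field =
  fixes f :: "'a::euclidean_space \<Rightarrow> 'a"
  assumes C1: "C1_vector_field f" and complete: "forward_complete f"
begin

lemma flow_solves: "solves_ode_on f (\<lambda>t. flow f t x) {0..}" and flow_0 [simp]: "flow f 0 x = x"
proof -
  obtain u where u: "u 0 = x" "solves_ode_on f u {0..}"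
    using complete unfolding forward_complete_def by blast
  have eq: "flow f t x = u t" if "t \<ge> 0" for t
  proof -
    have "closed_segment 0 t \<subseteq> {0..}"
      using that by (auto simp: closed_segment_eq_real_ivl)
    then show ?thesis
      using flow_eq_solution[OF C1 solves_ode_on_subset[OF u(2)]] u(1) by blast
  qed
  from eq[of 0] u(1) show "flow f 0 x = x" by simp
  show "solves_ode_on f (\<lambda>t. flow f t x) {0..}"
    unfolding solves_ode_on_def
  proof
    fix s :: real assume s: "s \<in> {0..}"
    then have "(u has_vector_derivative f (u s)) (at s within {0..})"
      using u(2) by (simp add: solves_ode_on_def)
    then have "((\<lambda>t. flow f t x) has_vector_derivative f (u s)) (at s within {0..})"
      by (rule has_vector_derivative_transform[OF s, rotated]) (simp add: eq)
    then show "((\<lambda>t. flow f t x) has_vector_derivative f (flow f s x)) (at s within {0..})"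
      using eq s by simp
  qed
qed

text \<open>Here \<open>t\<close> may be negative: the solution starting at \<open>x\<close> runs through \<open>flow f r x\<close> at time \<open>r\<close>
  and so provides the past of that point back to time \<open>-r\<close>.\<close>

lemma flow_flow:
  assumes "r \<ge> 0" "t + r \<ge> 0"
  shows "flow f t (flow f r x) = flow f (t + r) x"
proof -
  have "(\<lambda>s. s + r) ` closed_segment 0 t \<subseteq> {0..}"
    using assms by (auto simp: closed_segment_eq_real_ivl split: if_splits)
  from flow_eq_solution[OF C1 solves_ode_on_shift[OF flow_solves this]]
  show ?thesis by simp
qed

text \<open>For the time-\<open>s\<close> image, go back far enough: a point \<open>z\<close> of \<open>X\<close> that reaches \<open>x\<close> after
  time \<open>s + |t|\<close> reaches \<open>flow f t x\<close> after time \<open>s + (t + |t|)\<close>, and it is still in \<open>X\<close> after the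
  nonnegative time \<open>t + |t|\<close>.\<close>

lemma flow_on_global_attractor:
  assumes X: "forward_invariant f X" and x: "x \<in> global_attractor f X"
  shows "flow f t x \<in> global_attractor f X"
  unfolding global_attractor_def
proof
  fix s :: real assume s: "s \<in> {0..}"
  then have "s + \<bar>t\<bar> \<in> {0..}" by simp
  then obtain z where z: "z \<in> X" "x = flow f (s + \<bar>t\<bar>) z"
    using x unfolding global_attractor_def by blast
  have "flow f t x = flow f (t + (s + \<bar>t\<bar>)) z"
    unfolding z(2) using s by (intro flow_flow) auto
  also have "t + (s + \<bar>t\<bar>) = s + (t + \<bar>t\<bar>)"
    by simp
  also have "flow f (s + (t + \<bar>t\<bar>)) z = flow f s (flow f (t + \<bar>t\<bar>) z)"
    using s by (intro flow_flow[symmetric]) auto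
  finally have "flow f t x = flow f s (flow f (t + \<bar>t\<bar>) z)" .
  moreover have "flow f (t + \<bar>t\<bar>) z \<in> X"
    using X z(1) unfolding forward_invariant_def by (auto simp: image_subset_iff)
  ultimately show "flow f t x \<in> flow f s ` X"
    by simp
qed

text \<open>Near the time \<open>t\<close> the orbit of \<open>x\<close> is a shifted piece of the forward orbit of a point from
  which \<open>x\<close> is reached after time \<open>|t| + 1\<close>. The extra unit makes the shifted time positive, so that
  the derivative there is two-sided.\<close>

lemma flow_has_vector_derivative_on_global_attractor:
  assumes x: "x \<in> global_attractor f X"
  shows "((\<lambda>t. flow f t x) has_vector_derivative f (flow f t x)) (at t)"
proof -
  define T where "T = \<bar>t\<bar> + 1"
  have "T \<in> {0..}" by (simp add: T_def)
  then obtain z where z: "x = flow f T z"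
    using x unfolding global_attractor_def by blast
  have t: "t \<in> {-T<..}" by (auto simp: T_def)
  have eq: "flow f s x = flow f (s + T) z" if "s \<in> {-T<..}" for s
    unfolding z using that by (intro flow_flow) (auto simp: T_def)
  have "solves_ode_on f (\<lambda>s. flow f (s + T) z) {-T<..}"
    by (rule solves_ode_on_shift[OF flow_solves]) auto
  then have "((\<lambda>s. flow f (s + T) z) has_vector_derivative f (flow f (t + T) z)) (at t)"
    using t at_within_open[OF t open_greaterThan] unfolding solves_ode_on_def by metis
  then have "((\<lambda>s. flow f s x) has_vector_derivative f (flow f (t + T) z)) (at t)"
    by (rule has_vector_derivative_transform_within_open[OF _ _ t]) (auto simp: eq)
  then show ?thesis
    using eq[OF t] by simp
qed

end

section \<open>Linear equations and the exponential series\<close>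

text \<open>The \<open>k\<close>-th derivative of \<open>w\<close> is \<open>(g ^^ k) (w s)\<close>, which is at most \<open>(onorm g)\<^sup>k M\<close> in norm when
  \<open>M\<close> bounds \<open>w\<close> between \<open>- |t|\<close> and \<open>|t|\<close>. So the remainder in Taylor's formula at \<open>0\<close>, taken in
  each coordinate, is at most \<open>(|t| onorm g)\<^sup>n M / n!\<close> and tends to \<open>0\<close>.\<close>

lemma linear_ode_solution_sums:
  fixes w :: "real \<Rightarrow> 'a::euclidean_space"
  assumes g: "linear g" and w: "\<And>t. (w has_vector_derivative g (w t)) (at t)"
  shows "(\<lambda>k. t ^ k *\<^sub>R (g ^^ k) (w 0) /\<^sub>R fact k) sums w t"
proof -
  have bl: "bounded_linear g"
    using g by (simp add: linear_conv_bounded_linear)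
  have bound: "norm ((g ^^ k) v) \<le> onorm g ^ k * norm v" for k v
  proof (induction k)
    case (Suc k)
    have "norm ((g ^^ Suc k) v) \<le> onorm g * norm ((g ^^ k) v)"
      using onorm[OF bl] by simp
    also have "\<dots> \<le> onorm g * (onorm g ^ k * norm v)"
      using Suc onorm_pos_le[OF bl] by (rule mult_left_mono)
    finally show ?case by (simp add: mult.assoc)
  qed simp
  have deriv: "((\<lambda>s. (g ^^ k) (w s)) has_vector_derivative (g ^^ Suc k) (w s)) (at s)" for k s
  proof (induction k)
    case (Suc k)
    from bounded_linear.has_vector_derivative[OF bl this] show ?case by simp
  qed (use w in simp)
  have "continuous_on {- \<bar>t\<bar>..\<bar>t\<bar>} w"
    by (meson w has_vector_derivative_continuous continuous_at_imp_continuous_on)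
  then have "bounded (w ` {- \<bar>t\<bar>..\<bar>t\<bar>})"
    by (intro compact_imp_bounded compact_continuous_image) auto
  then obtain M where M: "\<And>s. \<bar>s\<bar> \<le> \<bar>t\<bar> \<Longrightarrow> norm (w s) \<le> M"
    unfolding bounded_iff by (metis abs_le_iff atLeastAtMost_iff imageI minus_le_iff)
  have "(\<lambda>n. (\<Sum>k<n. t ^ k *\<^sub>R (g ^^ k) (w 0) /\<^sub>R fact k) \<bullet> b) \<longlonglongrightarrow> w t \<bullet> b"
    if b: "b \<in> Basis" for b
  proof -
    define D where "D k s = (g ^^ k) (w s) \<bullet> b" for k s
    have D: "\<forall>k s. DERIV (D k) s :> D (Suc k) s"
      unfolding D_def has_real_derivative_iff_has_vector_derivative
      by (intro allI bounded_linear.has_vector_derivative[OF bounded_linear_inner_left deriv])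
    have "(\<lambda>n. (\<bar>t\<bar> * onorm g) ^ n /\<^sub>R fact n * M) \<longlonglongrightarrow> 0 * M"
      by (intro tendsto_mult tendsto_const summable_LIMSEQ_zero summable_exp_generic)
    then have lim: "(\<lambda>n. (\<bar>t\<bar> * onorm g) ^ n /\<^sub>R fact n * M) \<longlonglongrightarrow> 0"
      by simp
    have "(\<lambda>n. (\<Sum>k<n. t ^ k *\<^sub>R (g ^^ k) (w 0) /\<^sub>R fact k) \<bullet> b - w t \<bullet> b) \<longlonglongrightarrow> 0"
    proof (rule Lim_null_comparison[OF always_eventually lim], rule allI)
      fix n
      obtain s where s: "\<bar>s\<bar> \<le> \<bar>t\<bar>"
        "D 0 t = (\<Sum>k<n. D k 0 / fact k * t ^ k) + D n s / fact n * t ^ n"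
        using Maclaurin_all_le[OF refl D, of t n] by blast
      have "(\<Sum>k<n. t ^ k *\<^sub>R (g ^^ k) (w 0) /\<^sub>R fact k) \<bullet> b - w t \<bullet> b = - (D n s / fact n * t ^ n)"
        using s(2) by (simp add: D_def inner_sum_left divide_inverse mult_ac)
      moreover have "\<bar>D n s\<bar> \<le> onorm g ^ n * M"
      proof -
        have "\<bar>D n s\<bar> \<le> norm ((g ^^ n) (w s))"
          unfolding D_def using b by (rule Basis_le_norm)
        also have "\<dots> \<le> onorm g ^ n * norm (w s)"
          by (rule bound)
        also have "\<dots> \<le> onorm g ^ n * M"
          using M[OF s(1)] onorm_pos_le[OF bl] by (intro mult_left_mono) auto
        finally show ?thesis .
      qed
      then have "\<bar>D n s\<bar> * (\<bar>t\<bar> ^ n / fact n) \<le> onorm g ^ n * M * (\<bar>t\<bar> ^ n / fact n)"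
        by (rule mult_right_mono) simp
      ultimately show "norm ((\<Sum>k<n. t ^ k *\<^sub>R (g ^^ k) (w 0) /\<^sub>R fact k) \<bullet> b - w t \<bullet> b)
          \<le> (\<bar>t\<bar> * onorm g) ^ n /\<^sub>R fact n * M"
        by (simp add: abs_mult power_abs power_mult_distrib divide_inverse mult_ac)
    qed
    then show ?thesis
      by (rule LIM_zero_cancel)
  qed
  then show ?thesis
    unfolding sums_def by (subst tendsto_componentwise_iff) blast
qed

lemma has_vector_derivative_mem_subspace:
  fixes w :: "real \<Rightarrow> 'a::euclidean_space"
  assumes V: "subspace V" and w: "\<And>t. w t \<in> V" and D: "(w has_vector_derivative D) (at t)"
  shows "D \<in> V"
proof (rule Lim_in_closed_set[OF closed_subspace[OF V]])
  have "((\<lambda>h. norm (w (t + h) - w t - h *\<^sub>R D) / norm h) \<longlongrightarrow> 0) (at 0)"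
    using D unfolding has_vector_derivative_def has_derivative_at by blast
  then have "((\<lambda>h. (w (t + h) - w t) /\<^sub>R h - D) \<longlongrightarrow> 0) (at 0)"
  proof (rule Lim_null_comparison[rotated])
    have "norm ((w (t + h) - w t) /\<^sub>R h - D) \<le> norm (w (t + h) - w t - h *\<^sub>R D) / norm h"
      if "h \<noteq> 0" for h
    proof -
      have "(w (t + h) - w t) /\<^sub>R h - D = (w (t + h) - w t - h *\<^sub>R D) /\<^sub>R h"
        using that by (simp add: scaleR_diff_right)
      then show ?thesis by (simp add: divide_inverse mult.commute)
    qed
    then show "\<forall>\<^sub>F h in at 0. norm ((w (t + h) - w t) /\<^sub>R h - D)
        \<le> norm (w (t + h) - w t - h *\<^sub>R D) / norm h"
      by (simp add: eventually_at_filter)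
  qed
  then show "((\<lambda>h. (w (t + h) - w t) /\<^sub>R h) \<longlongrightarrow> D) (at 0)"
    by (rule LIM_zero_cancel)
  show "\<forall>\<^sub>F h in at 0. (w (t + h) - w t) /\<^sub>R h \<in> V"
    using w V by (intro always_eventually allI subspace_scale subspace_diff) auto
qed simp

text \<open>Lets facts about bounded linear maps of the whole space be applied to a linear map of a
  subspace.\<close>

lemma linear_transformation_on_extend:
  fixes B :: "'a::euclidean_space \<Rightarrow> 'a"
  assumes V: "subspace V" and B: "linear_transformation_on V B"
  shows "\<exists>g. linear g \<and> (\<forall>v\<in>V. g v = B v)"
proof -
  obtain S where S: "S \<subseteq> V" "independent S" "V \<subseteq> span S"
    using maximal_independent_subset[of V] by metis
  obtain g where g: "linear g" "\<forall>x\<in>S. g x = B x"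
    using linear_independent_extend[OF S(2)] by metis
  have "g x = B x \<and> x \<in> V" if "x \<in> span S" for x
    using that
  proof (induction rule: span_induct_alt)
    case base
    have "B 0 = 0"
      using B subspace_0[OF V] unfolding linear_transformation_on_def
      by (metis scale_zero_left)
    then show ?case using g(1) V by (simp add: linear_0 subspace_0)
  next
    case (step c x y)
    then have "x \<in> V" "y \<in> V" "c *\<^sub>R x \<in> V"
      using S(1) V by (auto simp: subspace_scale)
    then show ?case
      using B g step V
      by (simp add: linear_transformation_on_def linear_add linear_scale subspace_add)
  qed
  with g(1) S(3) show ?thesis by blast
qed

lemma op_exp_linear_ode:
  fixes B :: "'a::euclidean_space \<Rightarrow> 'a"
  assumes V: "subspace V" and B: "linear_transformation_on V B"
    and w: "\<And>t. w t \<in> V" "\<And>t. (w has_vector_derivative B (w t)) (at t)"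
  shows "w t = op_exp (\<lambda>v. t *\<^sub>R B v) (w 0)"
proof -
  obtain g where g: "linear g" "\<And>v. v \<in> V \<Longrightarrow> g v = B v"
    using linear_transformation_on_extend[OF V B] by blast
  have "((\<lambda>v. t *\<^sub>R B v) ^^ k) (w 0) = t ^ k *\<^sub>R (g ^^ k) (w 0) \<and> (g ^^ k) (w 0) \<in> V" for k
  proof (induction k)
    case (Suc k)
    moreover have "B (t ^ k *\<^sub>R (g ^^ k) (w 0)) = t ^ k *\<^sub>R B ((g ^^ k) (w 0))"
      "B ((g ^^ k) (w 0)) \<in> V"
      using Suc B by (auto simp: linear_transformation_on_def)
    ultimately show ?case
      using g(2) by simp
  qed (use w in simp)
  moreover have "(\<lambda>k. t ^ k *\<^sub>R (g ^^ k) (w 0) /\<^sub>R fact k) sums w t"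
    using w g by (intro linear_ode_solution_sums) auto
  ultimately show ?thesis
    by (simp add: op_exp_def sums_iff)
qed

section \<open>The isometries form an exponential\<close>

theorem lemma10:
  fixes f :: "real ^ 'n \<Rightarrow> real ^ 'n"
    and N :: "real ^ 'n \<Rightarrow> real"
    and X A V :: "(real ^ 'n) set"
    and F :: "real \<Rightarrow> real ^ 'n \<Rightarrow> real ^ 'n"
  assumes "C1_vector_field f"
    and "forward_complete f"
    and "compact X"
    and "forward_invariant f X"
    and "strictly_convex_norm N"
    and "nonexpansive_on N f X"
    and "A = global_attractor f X"
    and "0 \<in> A"
    and "f 0 = 0"
    and "V = span A"
    and "\<And>t. linear_isometry_on N V (F t)"
    and "\<And>t x. x \<in> A \<Longrightarrow> F t x = flow f t x"
  shows "\<exists>B. linear_transformation_on V B \<and>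
           (\<forall>t. \<forall>v\<in>V. F t v = op_exp (\<lambda>w. t *\<^sub>R B w) v)"
proof -
  interpret forward_complete_C1_field f
    by (unfold_locales) (use assms in auto)
  have V: "subspace V" and AV: "A \<subseteq> V"
    using assms(10) by (auto simp: span_superset)
  have F: "linear_transformation_on V (F t)" for t
    using assms(11) by (simp add: linear_isometry_on_def)
  then have F_V: "F t v \<in> V" if "v \<in> V" for t v
    using that unfolding linear_transformation_on_def by blast
  have F_lin: "F t (c *\<^sub>R a + v) = c *\<^sub>R F t a + F t v" if "a \<in> V" "v \<in> V" for t c a v
    using F[of t] that V by (simp add: linear_transformation_on_def subspace_scale)
  have F_zero: "F t 0 = 0" for t
    using F_lin[of 0 0 t "-1"] subspace_0[OF V] by simp
  have F_A: "F t a \<in> A" if "a \<in> A" for t a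
    using flow_on_global_attractor[OF assms(4)] that assms(7,12) by simp
  \<comment> \<open>On \<open>A\<close> the family \<open>F\<close> is the flow, so it inherits the differential equation.\<close>
  have F_A_deriv: "((\<lambda>t. F t a) has_vector_derivative f (F t a)) (at t)" if "a \<in> A" for t a
    using flow_has_vector_derivative_on_global_attractor that assms(7,12) by simp
  have F_0: "F 0 v = v" if "v \<in> V" for v
  proof -
    from that have "v \<in> V \<and> F 0 v = v"
      unfolding assms(10)
    proof (induction rule: span_induct_alt)
      case (step c a v)
      with AV V F_lin[of a v 0 c] assms(10,12) show ?case
        by (auto simp: span_base span_add span_scale)
    qed (simp add: F_zero span_zero)
    then show ?thesis ..
  qed
  \<comment> \<open>The infinitesimal generator of the family.\<close>
  define B where "B v = vector_derivative (\<lambda>t. F t v) (at 0)" for v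
  have B_eqI: "B v = y" if "((\<lambda>t. F t v) has_vector_derivative y) (at 0)" for v y
    unfolding B_def using that by (rule vector_derivative_at)
  have B_A: "B a = f a" if "a \<in> A" for a
    using B_eqI[OF F_A_deriv[OF that]] F_0 AV that by auto
  have F_diff_0: "((\<lambda>t. F t v) has_vector_derivative B v) (at 0)" if "v \<in> V" for v
  proof -
    from that have "v \<in> V \<and> (\<lambda>t. F t v) differentiable (at 0)"
      unfolding assms(10)
    proof (induction rule: span_induct_alt)
      case (step c a v)
      then have av: "a \<in> V" "v \<in> V" using AV assms(10) by auto
      have "(\<lambda>t. F t a) differentiable (at 0)"
        using F_A_deriv[OF step.hyps] by (rule differentiableI_vector)
      with step.IH have "(\<lambda>t. c *\<^sub>R F t a + F t v) differentiable (at 0)"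
        by (intro differentiable_add differentiable_scaleR differentiable_const) auto
      with av V show ?case
        using assms(10) by (simp add: F_lin subspace_add subspace_scale)
    qed (simp add: F_zero span_zero)
    then show ?thesis
      unfolding B_def vector_derivative_works[symmetric] by blast
  qed
  have B_lin: "B (c *\<^sub>R a + v) = c *\<^sub>R B a + B v" if "a \<in> V" "v \<in> V" for c a v
  proof (rule B_eqI)
    have "((\<lambda>t. c *\<^sub>R F t a + F t v) has_vector_derivative c *\<^sub>R B a + B v) (at 0)"
      using F_diff_0[OF that(1)] F_diff_0[OF that(2)] by (auto intro!: derivative_eq_intros)
    with that show "((\<lambda>t. F t (c *\<^sub>R a + v)) has_vector_derivative c *\<^sub>R B a + B v) (at 0)"
      by (simp add: F_lin)
  qed
  have B_zero: "B 0 = 0"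
    by (rule B_eqI) (simp add: F_zero)
  have B_V: "B v \<in> V" if "v \<in> V" for v
    using has_vector_derivative_mem_subspace[OF V F_V[OF that] F_diff_0[OF that]] .
  have B: "linear_transformation_on V B"
    unfolding linear_transformation_on_def
    using B_V B_lin[of _ _ 1] B_lin[of _ 0] B_zero subspace_0[OF V] by auto
  \<comment> \<open>The nonlinear equation on \<open>A\<close> is linear there, since the orbits remain in \<open>A\<close>, where \<open>f = B\<close>;
    as such it passes to linear combinations.\<close>
  have F_deriv: "((\<lambda>t. F t v) has_vector_derivative B (F t v)) (at t)" if "v \<in> V" for v t
  proof -
    from that have "v \<in> V \<and> (\<forall>t. ((\<lambda>t. F t v) has_vector_derivative B (F t v)) (at t))"
      unfolding assms(10)
    proof (induction rule: span_induct_alt)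
      case (step c a v)
      then have av: "a \<in> V" "v \<in> V" using AV assms(10) by auto
      have "((\<lambda>t. F t (c *\<^sub>R a + v)) has_vector_derivative B (F t (c *\<^sub>R a + v))) (at t)" for t
      proof -
        have "((\<lambda>t. F t a) has_vector_derivative B (F t a)) (at t)"
          using F_A_deriv[OF step.hyps] B_A[OF F_A[OF step.hyps]] by simp
        moreover have "((\<lambda>t. F t v) has_vector_derivative B (F t v)) (at t)"
          using step.IH by blast
        ultimately have "((\<lambda>t. c *\<^sub>R F t a + F t v) has_vector_derivative
            c *\<^sub>R B (F t a) + B (F t v)) (at t)"
          by (auto intro!: derivative_eq_intros)
        then show ?thesis
          by (simp add: F_lin av B_lin F_V)
      qed
      with av V show ?case
        using assms(10) by (auto simp: subspace_add subspace_scale)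
    qed (simp add: F_zero B_zero span_zero)
    then show ?thesis by blast
  qed
  have "F t v = op_exp (\<lambda>w. t *\<^sub>R B w) v" if "v \<in> V" for t v
    using op_exp_linear_ode[OF V B F_V[OF that] F_deriv[OF that]] F_0[OF that] by simp
  with B show ?thesis by blast
qed

end
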